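(* Let $\mathcal A$ be an approximate identity on $\mathbf{Sq}_\bot$. For every $m\in[0,\infty)$ and every $\varepsilon>0$, there is $\sigma\in\mathcal A$ such that, for every $(\mathbf c,r)\in[0,1]^2\times[0,m]$, $$0\le \mathrm R(\sigma(\mathbf c,r))-r\le\varepsilon .$$ In particular, for all $(\mathbf c,r)\in[0,1]^2\times[0,m]$ the output $\sigma(\mathbf c,r)$ is finite (i.e. different from $\bot$) and $$d_\infty\bigl(\mathrm C(\sigma(\mathbf c,r)),\mathbf c\bigr)\le \mathrm R(\sigma(\mathbf c,r))-r\le\varepsilon .$$
   Context: On $\mathbb R^2$, $d_\infty((x,y),(x',y'))=\max\{|x-x'|,|y-y'|\}$. $\mathbf{Sq}=[0,1]^2\times[0,\infty)$ is ordered by $(\mathbf c,r)\sqsubseteq(\mathbf c',r')\iff d_\infty(\mathbf c,\mathbf c')\le r-r'$, and $\mathbf{Sq}_\bot=\mathbf{Sq}\cup\{\bot\}$ with $\bot$ a new least element; $\mathbf{Sq}_\bot$ is a pointed dcpo (every directed subset has a supremum). For $(\mathbf c,r)\in\mathbf{Sq}$ put $\mathrm C(\mathbf c,r)=\mathbf c$ and $\mathrm R(\mathbf c,r)=r$; also $\mathrm R(\bot)=\infty$, with $\infty-r=\infty$, and $\mathrm C(\bot)$ is undefined. Elements of $\mathbf{Sq}$ are called finite. A subset $A$ of a poset is directed if every finite subset of $A$ (including the empty one) has an upper bound in $A$. A map between dcpos is Scott-continuous if it is monotone and preserves directed suprema; $[D\to D]$ is the set of Scott-continuous self-maps of $D$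 ordered pointwise (directed suprema are computed pointwise). An approximate identity on a pointed dcpo $D$ is a directed family $\mathcal A\subseteq[D\to D]$ with $\sup\mathcal A=\mathrm{id}_D$. *)

theory Defs
  imports "HOL-Analysis.Analysis" "HOL-Library.Lub_Glb" "HOL-Library.Option_ord"
begin

text \<open>
  Suprema are expressed by \<^const>\<open>isLub\<close>: \<open>isLub P A s\<close> says that \<open>s\<close> lies in \<open>P\<close> and is the
  least among those upper bounds of \<open>A\<close> that lie in \<open>P\<close>.
\<close>

definition directed :: "'a::order set \<Rightarrow> bool" where
  "directed A \<longleftrightarrow> (\<forall>F. finite F \<and> F \<subseteq> A \<longrightarrow> (\<exists>u\<in>A. \<forall>x\<in>F. x \<le> u))"

definition scott_continuous :: "('a::order \<Rightarrow> 'b::order) \<Rightarrow> bool" where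
  "scott_continuous f \<longleftrightarrow>
     mono f \<and> (\<forall>A s. directed A \<and> isLub UNIV A s \<longrightarrow> isLub UNIV (f ` A) (f s))"

text \<open>
  The order on functions is pointwise; the supremum of the family is taken in the poset of
  Scott-continuous self-maps, not in the poset of all self-maps.
\<close>

definition approximate_identity :: "('a::order \<Rightarrow> 'a) set \<Rightarrow> bool" where
  "approximate_identity \<A> \<longleftrightarrow>
     \<A> \<subseteq> {f. scott_continuous f} \<and> directed \<A> \<and> isLub {f. scott_continuous f} \<A> id"

definition d_inf :: "real \<times> real \<Rightarrow> real \<times> real \<Rightarrow> real" where
  "d_inf p q = max \<bar>fst p - fst q\<bar> \<bar>snd p - snd q\<bar>"

text \<open>
  \<open>Square\<close> is total on the raw type, but it is meaningful only on pairs \<open>(c, r)\<close> with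
  \<open>c\<close> in the unit square and \<open>r \<ge> 0\<close>.
\<close>

typedef sq = "({0..1} \<times> {0..1}) \<times> {0..} :: ((real \<times> real) \<times> real) set"
  morphisms coords Square
  by (rule exI[of _ "((0, 0), 0)"]) simp

instantiation sq :: order
begin

definition less_eq_sq :: "sq \<Rightarrow> sq \<Rightarrow> bool" where
  "p \<le> q \<longleftrightarrow> d_inf (fst (coords p)) (fst (coords q)) \<le> snd (coords p) - snd (coords q)"

definition less_sq :: "sq \<Rightarrow> sq \<Rightarrow> bool" where
  "p < q \<longleftrightarrow> p \<le> q \<and> \<not> q \<le> p" for p q :: sq

instance
proof
  fix p q s :: sq
  show "p < q \<longleftrightarrow> p \<le> q \<and> \<not> q \<le> p"
    by (rule less_sq_def)
  show "p \<le> p"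
    by (simp add: less_eq_sq_def d_inf_def)
  show "p \<le> s" if "p \<le> q" "q \<le> s"
    using that unfolding less_eq_sq_def d_inf_def by linarith
  show "p = q" if "p \<le> q" "q \<le> p"
  proof -
    have "coords p = coords q"
      using that unfolding less_eq_sq_def d_inf_def
      by (intro prod_eqI) linarith+
    then show ?thesis
      by (simp add: coords_inject)
  qed
qed

end

text \<open>The order on \<^typ>\<open>'a option\<close> adds \<^const>\<open>None\<close> as a new least element.\<close>

type_synonym sq_bot = "sq option"

definition R :: "sq_bot \<Rightarrow> ereal" where
  "R x = (case x of None \<Rightarrow> \<infinity> | Some p \<Rightarrow> ereal (snd (coords p)))"

definition C :: "sq_bot \<Rightarrow> real \<times> real" where
  "C x = (case x of None \<Rightarrow> undefined | Some p \<Rightarrow> fst (coords p))"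

end

theory Submission
  imports Defs
begin

text \<open>
  Every \<open>\<sigma>\<close> in the family lies below the identity, so by the definition of the order on
  squares \<open>\<sigma> (c, r)\<close> is either \<open>\<bottom>\<close> or a square whose radius exceeds \<open>r\<close> by at least the
  distance between the two centres.  Only the uniform upper bound \<open>R (\<sigma> (c, r)) \<le> r + \<epsilon>\<close>
  needs an argument, and it is Dini's: pointwise monotone convergence on a compact set is uniform.

  Pointwise convergence combines two facts.  In a directed-complete codomain the supremum of a
  directed family of Scott-continuous maps is pointwise (\<open>directed_lub_pointwise\<close>),
  because the pointwise supremum is Scott-continuous again.  And in \<open>Sq\<^sub>\<bottom>\<close> the radius turns a
  directed supremum into an infimum (\<open>radius_approximated\<close>).  Hence for each single square some
  \<open>\<sigma>\<close> enlarges its radius by as little as desired.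

  The local uniformity that Dini's argument needs comes from monotonicity of \<open>\<sigma>\<close>: the square
  \<open>(c, r + \<delta>)\<close> lies below every square \<open>(c', r')\<close> close enough to \<open>(c, r)\<close>, so a good bound on
  \<open>\<sigma> (c, r + \<delta>)\<close> is one on all these \<open>\<sigma> (c', r')\<close>.  Finitely many such neighbourhoods cover
  the compact set of squares in question, and the finitely many maps chosen for them have an upper
  bound in the directed family.
\<close>

section \<open>Directed suprema of Scott-continuous maps\<close>

lemma isLub_UNIV_iff:
  fixes s :: "'a::order"
  shows "isLub UNIV A s \<longleftrightarrow> (\<forall>a\<in>A. a \<le> s) \<and> (\<forall>t. (\<forall>a\<in>A. a \<le> t) \<longrightarrow> s \<le> t)"
  by (auto simp: isLub_def leastP_def isUb_def setle_def setge_def)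

lemma directed_nonempty: "directed A \<Longrightarrow> A \<noteq> {}"
  unfolding directed_def by blast

lemma directedE:
  assumes "directed A" "p \<in> A" "q \<in> A"
  obtains u where "u \<in> A" "p \<le> u" "q \<le> u"
proof -
  have "finite {p, q} \<and> {p, q} \<subseteq> A"
    using assms by simp
  with assms(1) obtain u where "u \<in> A" "\<forall>x\<in>{p, q}. x \<le> u"
    unfolding directed_def by blast
  then show thesis
    using that by simp
qed

lemma directed_image:
  assumes "directed A" "\<And>a b. a \<le> b \<Longrightarrow> f a \<le> f b"
  shows "directed (f ` A)"
  unfolding directed_def
proof (intro allI impI)
  fix F assume "finite F \<and> F \<subseteq> f ` A"
  then obtain G where G: "finite G" "G \<subseteq> A" "F = f ` G"
    by (meson finite_subset_image)
  with assms(1) obtain u where "u \<in> A" "\<forall>x\<in>G. x \<le> u"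
    unfolding directed_def by blast
  then show "\<exists>u\<in>f ` A. \<forall>x\<in>F. x \<le> u"
    using G(3) assms(2) by blast
qed

text \<open>
  The pointwise supremum \<open>g\<close> is Scott-continuous because suprema commute with suprema.  It is thus
  a competitor for the least upper bound among Scott-continuous maps, and so agrees with it.
\<close>

lemma directed_lub_pointwise:
  fixes \<F> :: "('a::order \<Rightarrow> 'b::order) set"
  assumes complete: "\<And>D :: 'b set. directed D \<Longrightarrow> \<exists>s. isLub UNIV D s"
    and scott: "\<F> \<subseteq> {f. scott_continuous f}"
    and dir: "directed \<F>"
    and lub: "isLub {f. scott_continuous f} \<F> h"
  shows "isLub UNIV ((\<lambda>f. f x) ` \<F>) (h x)"
proof -
  have "directed ((\<lambda>f. f x) ` \<F>)" for x
    by (rule directed_image[OF dir]) (simp add: le_fun_def)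
  then have "\<forall>x. \<exists>s. isLub UNIV ((\<lambda>f. f x) ` \<F>) s"
    using complete by blast
  then obtain g where g: "\<And>x. isLub UNIV ((\<lambda>f. f x) ` \<F>) (g x)"
    by metis
  have g_ub: "f x \<le> g x" if "f \<in> \<F>" for f x
    using g[of x] that unfolding isLub_UNIV_iff by blast
  have g_least: "g x \<le> t" if "\<And>f. f \<in> \<F> \<Longrightarrow> f x \<le> t" for x t
    using g[of x] that unfolding isLub_UNIV_iff by blast
  have \<F>_mono: "f x \<le> f y" if "f \<in> \<F>" "x \<le> y" for f x y
    using scott that unfolding scott_continuous_def by (blast dest: monoD)
  have g_mono: "g x \<le> g y" if "x \<le> y" for x y
    by (rule g_least) (rule order_trans[OF \<F>_mono[OF _ that] g_ub])
  have "isLub UNIV (g ` D) (g s)" if D: "directed D" "isLub UNIV D s" for D s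
    unfolding isLub_UNIV_iff
  proof (intro conjI allI impI)
    show "\<forall>a\<in>g ` D. a \<le> g s"
      using D(2) g_mono unfolding isLub_UNIV_iff by blast
    fix t assume t: "\<forall>a\<in>g ` D. a \<le> t"
    show "g s \<le> t"
    proof (rule g_least)
      fix f assume f: "f \<in> \<F>"
      then have "isLub UNIV (f ` D) (f s)"
        using scott D unfolding scott_continuous_def by blast
      moreover have "\<forall>a\<in>f ` D. a \<le> t"
        using g_ub[OF f] t by (auto intro: order_trans)
      ultimately show "f s \<le> t"
        unfolding isLub_UNIV_iff by blast
    qed
  qed
  then have "scott_continuous g"
    using g_mono unfolding scott_continuous_def by (auto intro: monoI)
  then have "h \<le> g"
    using lub g_ub by (auto simp: isLub_def leastP_def isUb_def setle_def setge_def le_fun_def)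
  moreover have "g \<le> h"
    using lub g_least by (auto simp: isLub_def leastP_def isUb_def setle_def le_fun_def)
  ultimately show ?thesis
    using g by simp
qed

section \<open>Directed suprema of squares\<close>

abbreviation radius :: "sq \<Rightarrow> real" where
  "radius p \<equiv> snd (coords p)"

abbreviation centre :: "sq \<Rightarrow> real \<times> real" where
  "centre p \<equiv> fst (coords p)"

lemma sq_le_iff:
  "p \<le> q \<longleftrightarrow> \<bar>fst (centre p) - fst (centre q)\<bar> \<le> radius p - radius q \<and>
              \<bar>snd (centre p) - snd (centre q)\<bar> \<le> radius p - radius q"
  by (simp add: less_eq_sq_def d_inf_def)

lemma radius_nonneg: "0 \<le> radius p"
  using coords[of p] by auto

lemma centre_bounds:
  "0 \<le> fst (centre p)" "fst (centre p) \<le> 1" "0 \<le> snd (centre p)" "snd (centre p) \<le> 1"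
  using coords[of p] by auto

text \<open>
  One coordinate of the centres along a directed set of squares: a net whose oscillation is
  controlled by a decreasing \<open>\<rho>\<close>.  The condition on \<open>f\<close> and \<open>\<rho>\<close> says that \<open>f - \<rho>\<close> and \<open>-f - \<rho>\<close>
  both increase, so the limit of \<open>f\<close> can be written as \<open>sup (f - \<rho>) + inf \<rho>\<close>, and its
  distance to the values of \<open>f\<close> is bounded by what \<open>\<rho>\<close> still has to lose.
\<close>

lemma directed_contracting_limit:
  fixes f \<rho> :: "'a::order \<Rightarrow> real"
  assumes dir: "directed D"
    and contr: "\<And>p q. p \<le> q \<Longrightarrow> \<bar>f p - f q\<bar> \<le> \<rho> p - \<rho> q"
    and nonneg: "\<And>p. 0 \<le> \<rho> p"
  shows "\<exists>l. \<forall>p\<in>D. \<bar>f p - l\<bar> \<le> \<rho> p - Inf (\<rho> ` D)"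
proof -
  define i where "i = Inf (\<rho> ` D)"
  define u where "u = Sup ((\<lambda>p. f p - \<rho> p) ` D)"
  have ne: "D \<noteq> {}"
    by (rule directed_nonempty[OF dir])
  have i_le: "i \<le> \<rho> p" if "p \<in> D" for p
    unfolding i_def using that nonneg by (intro cInf_lower bdd_belowI[of _ 0]) auto
  have bound: "f p - \<rho> p \<le> f q + \<rho> q - 2 * i" if pq: "p \<in> D" "q \<in> D" for p q
  proof -
    obtain w where "w \<in> D" "p \<le> w" "q \<le> w"
      using directedE[OF dir pq] by blast
    then show ?thesis
      using contr[of p w] contr[of q w] i_le[of w] by linarith
  qed
  obtain d where d: "d \<in> D"
    using ne by blast
  have "bdd_above ((\<lambda>p. f p - \<rho> p) ` D)"
    using bound[OF _ d] by (intro bdd_aboveI2)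
  then have lower: "f p - \<rho> p \<le> u" if "p \<in> D" for p
    unfolding u_def using that by (intro cSUP_upper)
  have upper: "u \<le> f q + \<rho> q - 2 * i" if "q \<in> D" for q
    unfolding u_def using ne bound that by (intro cSUP_least) auto
  have "\<bar>f p - (u + i)\<bar> \<le> \<rho> p - i" if "p \<in> D" for p
    using lower[OF that] upper[OF that] by linarith
  then show ?thesis
    unfolding i_def by blast
qed

text \<open>
  The supremum consists of the coordinatewise limits of the centres and the infimum of the radii.
  Members of \<open>D\<close> with radius close to this infimum have their centre close to the limit; hence the
  limit stays in the unit square, and the triangle inequality through such a member compares the
  candidate with any other upper bound.
\<close>

lemma directed_squares_lub:
  fixes D :: "sq set"
  assumes dir: "directed D"
  shows "\<exists>s. isLub UNIV D s \<and> radius s = Inf (radius ` D)"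
proof -
  define i where "i = Inf (radius ` D)"
  have ne: "D \<noteq> {}"
    by (rule directed_nonempty[OF dir])
  have i_nonneg: "0 \<le> i"
    unfolding i_def using ne radius_nonneg by (intro cInf_greatest) auto
  obtain a where a: "\<forall>p\<in>D. \<bar>fst (centre p) - a\<bar> \<le> radius p - i"
    using directed_contracting_limit[OF dir, of "\<lambda>p. fst (centre p)" radius]
    by (auto simp: i_def sq_le_iff radius_nonneg)
  obtain b where b: "\<forall>p\<in>D. \<bar>snd (centre p) - b\<bar> \<le> radius p - i"
    using directed_contracting_limit[OF dir, of "\<lambda>p. snd (centre p)" radius]
    by (auto simp: i_def sq_le_iff radius_nonneg)
  have near: "\<exists>p\<in>D. radius p < i + e" if "e > 0" for e
  proof -
    have "Inf (radius ` D) < i + e"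
      using that by (simp add: i_def)
    with ne show ?thesis
      using cInf_lessD[of "radius ` D" "i + e"] by auto
  qed
  have "0 \<le> a + e \<and> a \<le> 1 + e \<and> 0 \<le> b + e \<and> b \<le> 1 + e" if "e > 0" for e
  proof -
    obtain p where "p \<in> D" "radius p < i + e"
      using near \<open>e > 0\<close> by blast
    moreover from this a b
    have "\<bar>fst (centre p) - a\<bar> \<le> radius p - i" "\<bar>snd (centre p) - b\<bar> \<le> radius p - i"
      by auto
    ultimately show ?thesis
      using centre_bounds[of p] by linarith
  qed
  then have "0 \<le> a" "a \<le> 1" "0 \<le> b" "b \<le> 1"
    by - (rule field_le_epsilon, blast)+
  then have s: "coords (Square ((a, b), i)) = ((a, b), i)"
    using i_nonneg by (intro Square_inverse) auto
  have "isLub UNIV D (Square ((a, b), i))"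
    unfolding isLub_UNIV_iff
  proof (intro conjI allI impI)
    show "\<forall>p\<in>D. p \<le> Square ((a, b), i)"
      using a b by (simp add: sq_le_iff s)
    fix t assume t: "\<forall>p\<in>D. p \<le> t"
    have "\<bar>a - fst (centre t)\<bar> \<le> i - radius t + e \<and> \<bar>b - snd (centre t)\<bar> \<le> i - radius t + e"
      if "e > 0" for e
    proof -
      obtain p where p: "p \<in> D" "radius p < i + e / 2"
        using near[of "e / 2"] \<open>e > 0\<close> by auto
      then have "p \<le> t"
        using t by blast
      then have "\<bar>fst (centre p) - fst (centre t)\<bar> \<le> radius p - radius t"
        "\<bar>snd (centre p) - snd (centre t)\<bar> \<le> radius p - radius t"
        by (simp_all add: sq_le_iff)
      moreover have "\<bar>fst (centre p) - a\<bar> \<le> radius p - i" "\<bar>snd (centre p) - b\<bar> \<le> radius p - i"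
        using a b p(1) by auto
      ultimately show ?thesis
        using p(2) by linarith
    qed
    then have "\<bar>a - fst (centre t)\<bar> \<le> i - radius t" "\<bar>b - snd (centre t)\<bar> \<le> i - radius t"
      by - (rule field_le_epsilon, blast)+
    then show "Square ((a, b), i) \<le> t"
      by (simp add: sq_le_iff s)
  qed
  then show ?thesis
    using s by (auto simp: i_def)
qed

lemma directed_finite_part:
  fixes D :: "'a::order option set"
  assumes dir: "directed D" and "Some d \<in> D"
  shows "directed {p. Some p \<in> D}"
  unfolding directed_def
proof (intro allI impI)
  fix F assume F: "finite F \<and> F \<subseteq> {p. Some p \<in> D}"
  \<comment> \<open>The additional element \<open>d\<close> keeps the upper bound away from \<open>\<bottom>\<close> when \<open>F\<close> is empty.\<close>
  have "finite (Some ` insert d F) \<and> Some ` insert d F \<subseteq> D"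
    using F assms(2) by auto
  with dir obtain u where u: "u \<in> D" "\<forall>x\<in>Some ` insert d F. x \<le> u"
    unfolding directed_def by blast
  then obtain v where "u = Some v"
    by (cases u) auto
  with u show "\<exists>u\<in>{p. Some p \<in> D}. \<forall>x\<in>F. x \<le> u"
    by auto
qed

lemma isLub_Some:
  fixes D :: "'a::order option set"
  assumes "isLub UNIV {p. Some p \<in> D} s" and "Some d \<in> D"
  shows "isLub UNIV D (Some s)"
  unfolding isLub_UNIV_iff
proof (intro conjI allI impI)
  show "\<forall>x\<in>D. x \<le> Some s"
  proof
    fix x assume "x \<in> D"
    then show "x \<le> Some s"
      using assms(1) by (cases x) (auto simp: isLub_UNIV_iff)
  qed
  fix t assume t: "\<forall>x\<in>D. x \<le> t"
  then have "Some d \<le> t"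
    using assms(2) by blast
  then obtain u where u: "t = Some u"
    by (cases t) auto
  with t have "\<forall>a\<in>{p. Some p \<in> D}. a \<le> u"
    by auto
  then have "s \<le> u"
    using assms(1) unfolding isLub_UNIV_iff by blast
  with u show "Some s \<le> t"
    by simp
qed

lemma sq_bot_directed_complete:
  fixes D :: "sq_bot set"
  assumes "directed D"
  shows "\<exists>s. isLub UNIV D s"
proof (cases "\<exists>d. Some d \<in> D")
  case True
  then obtain d where "Some d \<in> D" by blast
  then show ?thesis
    using directed_squares_lub[OF directed_finite_part[OF assms]] isLub_Some by blast
next
  case False
  then have "\<forall>x\<in>D. x = None"
    by (metis option.exhaust)
  then have "isLub UNIV D None"
    by (auto simp: isLub_UNIV_iff)
  then show ?thesis ..
qed

text \<open>
  This is the form in which the radius turns directed suprema into infima: a supremum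
  other than \<open>\<bottom>\<close> is approached by elements other than \<open>\<bottom>\<close> of almost the same radius.
\<close>

lemma radius_approximated:
  fixes D :: "sq_bot set"
  assumes dir: "directed D" and lub: "isLub UNIV D (Some p)" and "0 < \<eta>"
  shows "\<exists>q. Some q \<in> D \<and> radius q < radius p + \<eta>"
proof -
  have "\<exists>d. Some d \<in> D"
  proof (rule ccontr)
    assume "\<nexists>d. Some d \<in> D"
    then have "\<forall>x\<in>D. x \<le> None"
      by (metis option.exhaust order_refl)
    with lub show False
      by (auto simp: isLub_UNIV_iff)
  qed
  then obtain d where d: "Some d \<in> D" by blast
  obtain s where s: "isLub UNIV {q. Some q \<in> D} s" "radius s = Inf (radius ` {q. Some q \<in> D})"
    using directed_squares_lub[OF directed_finite_part[OF dir d]] by blast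
  have "Some p \<le> Some s"
    using lub isLub_Some[OF s(1) d] unfolding isLub_UNIV_iff by blast
  then have "p \<le> s"
    by simp
  moreover have "s \<le> p"
    using lub s(1) unfolding isLub_UNIV_iff by (metis less_eq_option_Some mem_Collect_eq)
  ultimately have "s = p"
    by simp
  then have "Inf (radius ` {q. Some q \<in> D}) < radius p + \<eta>"
    using s(2) \<open>0 < \<eta>\<close> by simp
  then show ?thesis
    using cInf_lessD[of "radius ` {q. Some q \<in> D}" "radius p + \<eta>"] d by auto
qed

section \<open>Approximate identities\<close>

lemma approximate_identity_pointwise:
  fixes \<A> :: "(sq_bot \<Rightarrow> sq_bot) set"
  assumes "approximate_identity \<A>" and "0 < \<eta>"
  shows "\<exists>\<sigma>\<in>\<A>. \<exists>q. \<sigma> (Some p) = Some q \<and> radius q < radius p + \<eta>"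
proof -
  have \<A>: "\<A> \<subseteq> {f. scott_continuous f}" "directed \<A>" "isLub {f. scott_continuous f} \<A> id"
    using assms(1) unfolding approximate_identity_def by auto
  have "isLub UNIV ((\<lambda>\<sigma>. \<sigma> (Some p)) ` \<A>) (Some p)"
    using directed_lub_pointwise[OF sq_bot_directed_complete \<A>, of "Some p"] by simp
  moreover have "directed ((\<lambda>\<sigma>. \<sigma> (Some p)) ` \<A>)"
    by (rule directed_image[OF \<A>(2)]) (simp add: le_fun_def)
  ultimately obtain q where "Some q \<in> (\<lambda>\<sigma>. \<sigma> (Some p)) ` \<A>" "radius q < radius p + \<eta>"
    using radius_approximated assms(2) by blast
  then obtain \<sigma> where "\<sigma> \<in> \<A>" "\<sigma> (Some p) = Some q"
    by (elim imageE) simp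
  with \<open>radius q < radius p + \<eta>\<close> show ?thesis
    by blast
qed

text \<open>
  The local step of Dini's argument, applied to \<open>(c, r + \<delta>)\<close> instead of \<open>(c, r)\<close>: the surplus
  \<open>\<delta>\<close> in the radius makes room for moving both the centre and the radius by \<open>\<delta> / 2\<close>.  The
  loss \<open>3 * \<delta>\<close> covers this surplus, the error \<open>\<delta>\<close> of \<open>\<sigma>\<close> there, and the move of the radius.
\<close>

lemma approximate_identity_locally_uniform:
  fixes \<A> :: "(sq_bot \<Rightarrow> sq_bot) set"
  assumes ai: "approximate_identity \<A>" and "0 < \<delta>"
    and "c \<in> {0..1} \<times> {0..1}" and "0 \<le> r"
  shows "\<exists>\<sigma>\<in>\<A>. \<forall>p. dist (c, r) (coords p) < \<delta> / 2 \<longrightarrow>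
           (\<exists>q. \<sigma> (Some p) = Some q \<and> radius q < radius p + 3 * \<delta>)"
proof -
  define z where "z = Square (c, r + \<delta>)"
  have z: "coords z = (c, r + \<delta>)"
    unfolding z_def using assms by (intro Square_inverse) auto
  obtain \<sigma> w where \<sigma>: "\<sigma> \<in> \<A>" "\<sigma> (Some z) = Some w" "radius w < radius z + \<delta>"
    using approximate_identity_pointwise[OF ai \<open>0 < \<delta>\<close>] by blast
  have "mono \<sigma>"
    using ai \<sigma>(1) unfolding approximate_identity_def scott_continuous_def by blast
  have "\<exists>q. \<sigma> (Some p) = Some q \<and> radius q < radius p + 3 * \<delta>"
    if near: "dist (c, r) (coords p) < \<delta> / 2" for p
  proof -
    have r: "\<bar>r - radius p\<bar> < \<delta> / 2"
      using dist_snd_le[of "(c, r)" "coords p"] near by (simp add: dist_real_def)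
    have c: "dist c (centre p) < \<delta> / 2"
      using dist_fst_le[of "(c, r)" "coords p"] near by simp
    then have "\<bar>fst c - fst (centre p)\<bar> < \<delta> / 2" "\<bar>snd c - snd (centre p)\<bar> < \<delta> / 2"
      using dist_fst_le[of c "centre p"] dist_snd_le[of c "centre p"] by (auto simp: dist_real_def)
    with r have "\<bar>fst c - fst (centre p)\<bar> \<le> r + \<delta> - radius p"
      "\<bar>snd c - snd (centre p)\<bar> \<le> r + \<delta> - radius p"
      by linarith+
    then have "z \<le> p"
      by (simp add: sq_le_iff z)
    then have "Some w \<le> \<sigma> (Some p)"
      using monoD[OF \<open>mono \<sigma>\<close>, of "Some z" "Some p"] \<sigma>(2) by simp
    then obtain q where q: "\<sigma> (Some p) = Some q" "w \<le> q"
      by (cases "\<sigma> (Some p)") auto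
    then have "radius q \<le> radius w"
      unfolding sq_le_iff by linarith
    then have "radius q < radius p + 3 * \<delta>"
      using \<sigma>(3) r unfolding z snd_conv by linarith
    with q(1) show ?thesis
      by blast
  qed
  with \<sigma>(1) show ?thesis
    by blast
qed

lemma approximate_identity_uniform:
  fixes \<A> :: "(sq_bot \<Rightarrow> sq_bot) set"
  assumes ai: "approximate_identity \<A>" and "0 < \<epsilon>"
  shows "\<exists>\<sigma>\<in>\<A>. \<forall>p. radius p \<le> m \<longrightarrow>
           (\<exists>q. \<sigma> (Some p) = Some q \<and> radius q \<le> radius p + \<epsilon>)"
proof -
  define \<delta> where "\<delta> = \<epsilon> / 3"
  have "0 < \<delta>"
    using \<open>0 < \<epsilon>\<close> by (simp add: \<delta>_def)
  define K :: "((real \<times> real) \<times> real) set" where "K = ({0..1} \<times> {0..1}) \<times> {0..m}"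
  have "compact K"
    unfolding K_def by (intro compact_Times compact_Icc)
  then have totally_bounded: "\<forall>e>0. \<exists>k. finite k \<and> k \<subseteq> K \<and> K \<subseteq> (\<Union>x\<in>k. ball x e)"
    by (intro seq_compact_imp_totally_bounded) (simp add: compact_eq_seq_compact_metric)
  obtain k where k: "finite k" "k \<subseteq> K" "K \<subseteq> (\<Union>x\<in>k. ball x (\<delta> / 2))"
    using totally_bounded[THEN spec, THEN mp, OF half_gt_zero[OF \<open>0 < \<delta>\<close>]] by (elim exE conjE)
  define good where "good x \<sigma> \<longleftrightarrow> (\<forall>p. dist x (coords p) < \<delta> / 2 \<longrightarrow>
      (\<exists>q. \<sigma> (Some p) = Some q \<and> radius q < radius p + 3 * \<delta>))"
    for x and \<sigma> :: "sq_bot \<Rightarrow> sq_bot"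
  have "\<exists>\<sigma>. \<sigma> \<in> \<A> \<and> good x \<sigma>" if "x \<in> k" for x
  proof -
    have "fst x \<in> {0..1} \<times> {0..1}" "0 \<le> snd x"
      using k(2) that by (auto simp: K_def)
    from approximate_identity_locally_uniform[OF ai \<open>0 < \<delta>\<close> this]
    show ?thesis
      unfolding prod.collapse good_def Bex_def .
  qed
  then have "\<forall>x\<in>k. \<exists>\<sigma>. \<sigma> \<in> \<A> \<and> good x \<sigma>"
    by blast
  from bchoice[OF this] obtain S where S: "\<forall>x\<in>k. S x \<in> \<A> \<and> good x (S x)"
    by blast
  have "finite (S ` k) \<and> S ` k \<subseteq> \<A>"
    using k(1) S by auto
  moreover have "\<forall>F. finite F \<and> F \<subseteq> \<A> \<longrightarrow> (\<exists>u\<in>\<A>. \<forall>f\<in>F. f \<le> u)"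
    using ai unfolding approximate_identity_def directed_def by (elim conjE)
  ultimately have "\<exists>\<sigma>\<in>\<A>. \<forall>f\<in>S ` k. f \<le> \<sigma>"
    by (elim allE[where x = "S ` k"] mp)
  then obtain \<sigma> where \<sigma>: "\<sigma> \<in> \<A>" "\<forall>f\<in>S ` k. f \<le> \<sigma>"
    by (elim bexE)
  have "\<exists>q. \<sigma> (Some p) = Some q \<and> radius q \<le> radius p + \<epsilon>" if "radius p \<le> m" for p
  proof -
    have "coords p \<in> K"
      using that coords[of p] by (auto simp: K_def)
    then obtain x where x: "x \<in> k" "dist x (coords p) < \<delta> / 2"
      using k(3) by auto
    then obtain w where w: "S x (Some p) = Some w" "radius w < radius p + 3 * \<delta>"
      using S unfolding good_def by blast
    have "S x (Some p) \<le> \<sigma> (Some p)"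
      using \<sigma>(2) x(1) by (simp add: le_fun_def)
    then obtain q where q: "\<sigma> (Some p) = Some q" "w \<le> q"
      using w(1) by (cases "\<sigma> (Some p)") auto
    then have "radius q \<le> radius w"
      unfolding sq_le_iff by linarith
    then show ?thesis
      using q(1) w(2) by (simp add: \<delta>_def)
  qed
  with \<sigma>(1) show ?thesis
    by blast
qed

theorem theorem4p2:
  fixes \<A> :: "(sq_bot \<Rightarrow> sq_bot) set" and m \<epsilon> :: real
  assumes "approximate_identity \<A>" and "0 \<le> m" and "0 < \<epsilon>"
  shows "\<exists>\<sigma>\<in>\<A>. \<forall>c \<in> {0..1} \<times> {0..1}. \<forall>r \<in> {0..m}.
           (let y = \<sigma> (Some (Square (c, r))) in
              0 \<le> R y - ereal r \<and> R y - ereal r \<le> ereal \<epsilon> \<and>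
              y \<noteq> bot \<and>
              ereal (d_inf (C y) c) \<le> R y - ereal r)"
proof -
  obtain \<sigma> where \<sigma>: "\<sigma> \<in> \<A>"
    and bound: "\<And>p. radius p \<le> m \<Longrightarrow> \<exists>q. \<sigma> (Some p) = Some q \<and> radius q \<le> radius p + \<epsilon>"
    using approximate_identity_uniform[OF assms(1,3), of m] by blast
  have below_id: "\<sigma> x \<le> x" for x
    using assms(1) \<sigma>
    by (auto simp: approximate_identity_def isLub_def leastP_def isUb_def setle_def le_fun_def)
  have "let y = \<sigma> (Some (Square (c, r))) in
          0 \<le> R y - ereal r \<and> R y - ereal r \<le> ereal \<epsilon> \<and> y \<noteq> bot \<and>
          ereal (d_inf (C y) c) \<le> R y - ereal r"
    if c: "c \<in> {0..1} \<times> {0..1}" and r: "r \<in> {0..m}" for c r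
  proof -
    have p: "coords (Square (c, r)) = (c, r)"
      using c r by (intro Square_inverse) auto
    then obtain q where q: "\<sigma> (Some (Square (c, r))) = Some q" "radius q \<le> r + \<epsilon>"
      using bound[of "Square (c, r)"] r by auto
    have "q \<le> Square (c, r)"
      using below_id[of "Some (Square (c, r))"] q(1) by simp
    then have "d_inf (centre q) c \<le> radius q - r"
      by (simp add: less_eq_sq_def p)
    moreover have "0 \<le> d_inf (centre q) c"
      by (simp add: d_inf_def)
    ultimately show ?thesis
      using q by (simp add: R_def C_def bot_option_def)
  qed
  with \<sigma> show ?thesis
    by blast
qed

end
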